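(* Let $C_n\subseteq\mathbb{R}^{\binom{n}{2}}$ be a cone satisfying (i) the cuts are extreme rays of $C_n$; (ii) the triangle inequalities are facet-inducing for $C_n$. Then any isometry of $C_n$ is induced by a permutation on $\{1,\dots,n\}$.
   Context: Points of $\mathbb{R}^{\binom{n}{2}}$ are written $x=(x_{ij})_{1\le i<j\le n}$, with the convention $x_{ji}=x_{ij}$, and $\mathbb{R}^{\binom{n}{2}}$ carries its standard Euclidean structure. Cones here are polyhedra. For $S\subseteq\{1,\dots,n\}$, the cut $\delta(S)\in\mathbb{R}^{\binom{n}{2}}$ is the vector with $\delta(S)_{ij}=1$ if exactly one of $i,j$ lies in $S$, and $\delta(S)_{ij}=0$ otherwise, for $1\le i<j\le n$. Condition (i) means that each nonzero cut spans an extreme ray of $C_n$. The triangle inequalities are the inequalities $x_{ij}-x_{ik}-x_{jk}\le 0$ for distinct $i,j,k\in\{1,\dots,n\}$. An inequality $\langle a,x\rangle\le 0$ is facet-inducing for $C_n$ if it is valid for all $x\in C_n$ and $\{x\in C_n:\langle a,x\rangle=0\}$ is a facet of $C_n$ (a face of codimension $1$). An isometry of $C_n$ is a linear transformation $g$ of $\mathbb{R}^{\binom{n}{2}}$ that preserves the Euclidean distance and satisfies $g(C_n)=C_n$. It is induced by a permutation $\sigma$ of $\{1,\dots,n\}$ if it is the coordinate permutation $g(x)_{\sigma(i)\sigma(j)}=x_{ij}$ for all $i\ne j$ and all $x$.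
   Formalization: The case n = 4 is excluded, since there the claim fails: the only such cone is the cut cone, and the reflection in δ({1}) − δ({2}) is an isometry of it not induced by a permutation. Also n ≥ 2 is assumed, which omits only the zero-dimensional space. *)

theory Defs
  imports "HOL-Analysis.Analysis"
begin

(* The type variable 'n plays the role of {1,...,n}, with n = CARD('n); the class card2 is
   "finite with at least two elements" (HOL-Library.Numeral_Type), so that there is an edge. *)
typedef (overloaded) ('n::card2) edge = "{e :: 'n set. card e = 2}"
proof -
  have "\<exists>e \<subseteq> (UNIV :: 'n set). card e = 2"
    using two_le_card[where 'a = 'n] by (metis obtain_subset_with_card_n)
  then show ?thesis by blast
qed

instance edge :: (card2) finite
proof
  have "range (Rep_edge :: 'a edge \<Rightarrow> 'a set) \<subseteq> UNIV" by simp
  then have "finite (range (Rep_edge :: 'a edge \<Rightarrow> 'a set))"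
    using finite by (rule finite_subset)
  then show "finite (UNIV :: 'a edge set)"
    by (rule finite_imageD) (simp add: inj_on_def Rep_edge_inject)
qed

type_synonym 'n edge_space = "real ^ 'n edge"

(* Only meaningful for i \<noteq> j. *)
definition uedge :: "'n::card2 \<Rightarrow> 'n \<Rightarrow> 'n edge" where
  "uedge i j = Abs_edge {i, j}"

abbreviation coord :: "'n::card2 edge_space \<Rightarrow> 'n \<Rightarrow> 'n \<Rightarrow> real" where
  "coord x i j \<equiv> x $ uedge i j"

lemma Rep_uedge: "i \<noteq> j \<Longrightarrow> Rep_edge (uedge i j) = {i, j}"
  by (simp add: uedge_def Abs_edge_inverse)

lemma uedge_commute: "uedge i j = uedge j i"
  by (simp add: uedge_def insert_commute)

lemma uedge_cases:
  obtains i j where "i \<noteq> j" and "e = uedge i j"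
proof -
  have "card (Rep_edge e) = 2" using Rep_edge[of e] by simp
  then obtain i j where ij: "Rep_edge e = {i, j}" "i \<noteq> j" by (auto simp: card_2_iff)
  then have "e = uedge i j" by (metis Rep_uedge Rep_edge_inject)
  with ij(2) show ?thesis by (rule that)
qed

definition cut_vec :: "'n::card2 set \<Rightarrow> 'n edge_space" where
  "cut_vec S = (\<chi> e. if card (Rep_edge e \<inter> S) = 1 then 1 else 0)"

lemma coord_cut_vec:
  assumes "i \<noteq> j"
  shows "coord (cut_vec S) i j = (if (i \<in> S) \<noteq> (j \<in> S) then 1 else 0)"
  using assms by (auto simp: cut_vec_def Rep_uedge Int_insert_left)

definition spans_extreme_ray :: "'v::euclidean_space \<Rightarrow> 'v set \<Rightarrow> bool" where
  "spans_extreme_ray v C \<longleftrightarrow> v \<noteq> 0 \<and> (cone hull {v}) face_of C"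

definition facet_inducing :: "'v::euclidean_space \<Rightarrow> 'v set \<Rightarrow> bool" where
  "facet_inducing a C \<longleftrightarrow> (\<forall>x\<in>C. a \<bullet> x \<le> 0) \<and> {x \<in> C. a \<bullet> x = 0} facet_of C"

definition triangle_vec :: "'n::card2 \<Rightarrow> 'n \<Rightarrow> 'n \<Rightarrow> 'n edge_space" where
  "triangle_vec i j k =
     axis (uedge i j) 1 - axis (uedge i k) 1 - axis (uedge j k) 1"

lemma inner_triangle_vec:
  "triangle_vec i j k \<bullet> x = coord x i j - coord x i k - coord x j k"
  by (simp add: triangle_vec_def inner_diff_left inner_axis')

definition cone_isometry :: "('v::euclidean_space \<Rightarrow> 'v) \<Rightarrow> 'v set \<Rightarrow> bool" where
  "cone_isometry g C \<longleftrightarrow>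
     linear g \<and> (\<forall>x y. dist (g x) (g y) = dist x y) \<and> g ` C = C"

definition induced_by :: "('n::card2 edge_space \<Rightarrow> 'n edge_space) \<Rightarrow> ('n \<Rightarrow> 'n) \<Rightarrow> bool" where
  "induced_by g \<sigma> \<longleftrightarrow>
     (\<forall>x i j. i \<noteq> j \<longrightarrow> coord (g x) (\<sigma> i) (\<sigma> j) = coord x i j)"

end

theory Submission
  imports Defs
begin

text \<open>The triangle inequalities put \<open>C\<close> between the cuts and the cone of semimetrics. For semimetrics
  \<open>x, y\<close> on \<open>n\<close> points and an edge \<open>a b\<close> on which \<open>x\<close> is maximal, summing the triangle inequalities
  over triples gives \<open>(n - 1) \<langle>x, y\<rangle> \<ge> x a b * \<Sum> y\<close>. Multiplying by the same bound with \<open>x, y\<close>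
  exchanged, \<open>(n - 1) \<langle>x, y\<rangle> \<ge> \<bar>x\<bar> \<bar>y\<bar>\<close>, with equality only if \<open>x\<close> and \<open>y\<close> are multiples of
  cuts at two different single points. An isometry therefore permutes the cuts \<open>\<delta>({i})\<close>, which
  defines \<open>\<sigma>\<close>.

  The image of the normal of a triangle inequality with apex \<open>k\<close> is nonpositive on the cuts, has
  norm \<open>\<surd>3\<close> and has prescribed products with the cuts \<open>\<delta>({l})\<close>; this forces it to be such a normal
  with apex \<open>\<sigma> k\<close>. Since \<open>-2 e\<^sub>j\<^sub>k\<close> is the sum of the normals with apices \<open>k\<close> and \<open>j\<close> of the triangle
  \<open>i j k\<close>, for each of the at least three \<open>i\<close> available when \<open>n \<ge> 5\<close>, its image can only be
  \<open>-2\<close> times the unit vector of the edge \<open>\<sigma> j, \<sigma> k\<close>.\<close>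

section \<open>Edge vectors as symmetric functions\<close>

text \<open>Zero on the diagonal because \<open>uedge i i\<close> is not meaningful as an edge. Sums
  can then run over all ordered pairs, and the semimetric laws make sense for coinciding
  points.\<close>

definition dst :: "'n::card2 edge_space \<Rightarrow> 'n \<Rightarrow> 'n \<Rightarrow> real" where
  "dst x i j = (if i = j then 0 else coord x i j)"

lemma dst_same [simp]: "dst x i i = 0"
  by (simp add: dst_def)

lemma dst_commute: "dst x i j = dst x j i"
  by (simp add: dst_def uedge_commute)

lemma edge_space_eqI:
  assumes "\<And>i j. i \<noteq> j \<Longrightarrow> coord x i j = coord y i j"
  shows "x = y"
  unfolding vec_eq_iff by (metis assms uedge_cases)

lemma uedge_eq_iff:
  assumes "i \<noteq> j" "k \<noteq> l"
  shows "uedge i j = uedge k l \<longleftrightarrow> {i, j} = {k, l}"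
  using assms by (metis Rep_uedge uedge_def)

text \<open>Grouping the ordered pairs by their edge, every fibre is
  \<open>{(i, j), (j, i)}\<close>. This is where the factor 2 in the later double sums comes
  from.\<close>

lemma sum_offdiag_uedge:
  fixes f :: "'n::card2 edge \<Rightarrow> real"
  shows "(\<Sum>i\<in>UNIV. \<Sum>j\<in>UNIV. if i = j then 0 else f (uedge i j)) = 2 * (\<Sum>e\<in>UNIV. f e)"
proof -
  let ?D = "{p :: 'n \<times> 'n. fst p \<noteq> snd p}"
  let ?u = "\<lambda>p :: 'n \<times> 'n. uedge (fst p) (snd p)"
  have "(\<Sum>i\<in>UNIV. \<Sum>j\<in>UNIV. if i = j then 0 else f (uedge i j))
      = (\<Sum>p\<in>UNIV. if fst p = snd p then 0 else f (?u p))"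
    by (simp add: sum.cartesian_product case_prod_unfold)
  also have "\<dots> = (\<Sum>p\<in>?D. f (?u p))"
    by (rule sum.mono_neutral_cong_right) auto
  also have "\<dots> = (\<Sum>e\<in>UNIV. \<Sum>p\<in>{p \<in> ?D. ?u p = e}. f (?u p))"
    by (rule sum.group[symmetric]) auto
  also have "\<dots> = (\<Sum>e\<in>UNIV. 2 * f e)"
  proof (rule sum.cong[OF refl])
    fix e :: "'n edge"
    obtain i j where ij: "i \<noteq> j" "e = uedge i j" by (rule uedge_cases)
    then have "{p \<in> ?D. ?u p = e} = {(i, j), (j, i)}"
      by (auto simp: uedge_eq_iff doubleton_eq_iff)
    then show "(\<Sum>p\<in>{p \<in> ?D. ?u p = e}. f (?u p)) = 2 * f e"
      using ij by (simp add: uedge_commute)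
  qed
  finally show ?thesis by (simp add: sum_distrib_left)
qed

lemma inner_dst: "(\<Sum>i\<in>UNIV. \<Sum>j\<in>UNIV. dst x i j * dst y i j) = 2 * (x \<bullet> y)"
proof -
  have "(\<Sum>i\<in>UNIV. \<Sum>j\<in>UNIV. dst x i j * dst y i j)
      = (\<Sum>i\<in>UNIV. \<Sum>j\<in>UNIV. if i = j then 0 else (\<lambda>e. x $ e * y $ e) (uedge i j))"
    by (intro sum.cong refl) (simp add: dst_def)
  then show ?thesis
    using sum_offdiag_uedge[of "\<lambda>e. x $ e * y $ e"] by (simp add: inner_vec_def)
qed

lemma coord_axis:
  assumes "i \<noteq> j" "k \<noteq> l"
  shows "coord (axis (uedge i j) c) k l = (if {i, j} = {k, l} then c else 0)"
  using assms by (auto simp: axis_def uedge_eq_iff)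

lemma inner_axis_uedge: "x \<bullet> axis (uedge i j) 1 = coord x i j"
  by (simp add: inner_axis)

lemma inner_cut_single: "x \<bullet> cut_vec {i} = (\<Sum>j\<in>UNIV. dst x i j)"
proof -
  have "2 * (x \<bullet> cut_vec {i}) = (\<Sum>p\<in>UNIV. \<Sum>q\<in>UNIV. dst x p q * dst (cut_vec {i}) p q)"
    by (simp add: inner_dst)
  also have "\<dots> = (\<Sum>p\<in>UNIV. \<Sum>q\<in>UNIV.
      (if p = i then dst x p q else 0) + (if q = i then dst x p q else 0))"
    by (intro sum.cong refl) (auto simp: dst_def coord_cut_vec)
  also have "\<dots> = (\<Sum>q\<in>UNIV. dst x i q) + (\<Sum>p\<in>UNIV. dst x p i)"
    by (simp add: sum.distrib sum.delta if_distrib[of "sum _"] sum.swap[of "\<lambda>p q. if p = i then _ p q else 0"])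
  also have "\<dots> = 2 * (\<Sum>q\<in>UNIV. dst x i q)"
    by (simp add: dst_commute[of x _ i])
  finally show ?thesis by simp
qed

text \<open>The sum of the two single cuts has the value 2 on the edge \<open>i j\<close>, which
  \<open>{i, j}\<close> does not cut, and is right on all other edges. Products with cuts of one and
  two points therefore give access to single coordinates.\<close>

lemma cut_pair:
  assumes "i \<noteq> j"
  shows "cut_vec {i, j} = cut_vec {i} + cut_vec {j} - 2 *\<^sub>R axis (uedge i j) 1"
  using assms by (intro edge_space_eqI) (auto simp: coord_cut_vec coord_axis doubleton_eq_iff)

lemma inner_cut_pair:
  assumes "i \<noteq> j"
  shows "x \<bullet> cut_vec {i, j} = x \<bullet> cut_vec {i} + x \<bullet> cut_vec {j} - 2 * coord x i j"
  using assms by (simp add: cut_pair inner_diff_right inner_add_right inner_axis_uedge)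

lemma coord_triangle_vec:
  assumes "i \<noteq> j" "i \<noteq> k" "j \<noteq> k" "p \<noteq> q"
  shows "coord (triangle_vec i j k) p q =
    (if {p, q} = {i, j} then 1 else 0) - (if {p, q} = {i, k} then 1 else 0)
      - (if {p, q} = {j, k} then 1 else 0)"
  using assms by (auto simp: triangle_vec_def coord_axis)

lemma triangle_vec_commute: "triangle_vec i j k = triangle_vec j i k"
  by (simp add: triangle_vec_def uedge_commute)

lemma norm_triangle_vec:
  assumes "i \<noteq> j" "i \<noteq> k" "j \<noteq> k"
  shows "triangle_vec i j k \<bullet> triangle_vec i j k = 3"
  using assms by (simp add: inner_triangle_vec coord_triangle_vec doubleton_eq_iff)

lemma triangle_vec_sum:
  assumes "i \<noteq> j" "i \<noteq> k" "j \<noteq> k"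
  shows "triangle_vec i j k + triangle_vec i k j = - 2 *\<^sub>R axis (uedge j k) 1"
  using assms by (intro edge_space_eqI) (auto simp: coord_triangle_vec coord_axis doubleton_eq_iff)

lemma triangle_vec_inject:
  assumes "i \<noteq> j" "i \<noteq> k" "j \<noteq> k" "l \<noteq> j" "l \<noteq> k"
    and "triangle_vec i j k = triangle_vec l j k"
  shows "i = l"
proof -
  have "coord (triangle_vec i j k) i j = coord (triangle_vec l j k) i j"
    using assms(6) by simp
  then show ?thesis
    using assms(1-5) by (auto simp: coord_triangle_vec doubleton_eq_iff split: if_splits)
qed

text \<open>The cut at the apex \<open>k\<close> meets the two negative edges; a cut at
  \<open>i\<close> or \<open>j\<close> meets the positive and one negative edge. These products thus
  reveal the apex.\<close>

lemma triangle_inner_cut_single: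
  assumes "i \<noteq> j" "i \<noteq> k" "j \<noteq> k"
  shows "triangle_vec i j k \<bullet> cut_vec {l} = (if l = k then - 2 else 0)"
  using assms by (auto simp: inner_triangle_vec coord_cut_vec)

lemma cut_single_inner_cut_single:
  fixes i j :: "'n::card2"
  shows "cut_vec {i} \<bullet> cut_vec {j} = (if i = j then real CARD('n) - 1 else 1)"
proof -
  have "cut_vec {i} \<bullet> cut_vec {j} = (\<Sum>q\<in>UNIV - {j}. if (i = j) \<or> (q = i) then 1 else 0 :: real)"
    unfolding inner_cut_single
    by (rule sum.mono_neutral_cong_right) (auto simp: dst_def coord_cut_vec)
  then show ?thesis
    by (cases "i = j") (auto simp: card_Diff_singleton of_nat_diff)
qed


section \<open>The angle between two semimetrics\<close>

definition semimetric :: "('a \<Rightarrow> 'a \<Rightarrow> real) \<Rightarrow> bool" where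
  "semimetric d \<longleftrightarrow> (\<forall>i. d i i = 0) \<and> (\<forall>i j. d i j = d j i) \<and> (\<forall>i j k. d i j \<le> d i k + d k j)"

lemma semimetric_same: "semimetric d \<Longrightarrow> d i i = 0"
  and semimetric_commute: "semimetric d \<Longrightarrow> d i j = d j i"
  and semimetric_triangle: "semimetric d \<Longrightarrow> d i j \<le> d i k + d k j"
  unfolding semimetric_def by blast+

lemma semimetric_nonneg: "semimetric d \<Longrightarrow> 0 \<le> d i j"
  using semimetric_triangle[of d i i j] semimetric_same[of d i] semimetric_commute[of d i j] by simp

lemma sum_sum_split_pair:
  fixes f :: "'a::finite \<Rightarrow> 'a \<Rightarrow> real"
  assumes "\<And>i. f i i = 0" "\<And>i j. f i j = f j i" "a \<noteq> b"
  shows "(\<Sum>i\<in>UNIV. \<Sum>j\<in>UNIV. f i j) =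
    2 * f a b + 2 * (\<Sum>i\<in>-{a,b}. f a i + f b i) + (\<Sum>i\<in>-{a,b}. \<Sum>j\<in>-{a,b}. f i j)"
proof -
  have *: "(\<Sum>i\<in>UNIV. h i) = h a + h b + (\<Sum>i\<in>-{a,b}. h i)" for h :: "'a \<Rightarrow> real"
  proof -
    have "(\<Sum>i\<in>UNIV. h i) = (\<Sum>i\<in>insert a (insert b (-{a,b})). h i)"
      by (rule sum.cong) auto
    then show ?thesis using assms(3) by simp
  qed
  have "(\<Sum>i\<in>-{a,b}. f i a + f i b + (\<Sum>j\<in>-{a,b}. f i j))
      = (\<Sum>i\<in>-{a,b}. f a i + f b i) + (\<Sum>i\<in>-{a,b}. \<Sum>j\<in>-{a,b}. f i j)"
    by (simp add: sum.distrib assms(2)[of _ a] assms(2)[of _ b])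
  moreover have "(\<Sum>i\<in>UNIV. \<Sum>j\<in>UNIV. f i j) = (\<Sum>i\<in>UNIV. f i a + f i b + (\<Sum>j\<in>-{a,b}. f i j))"
    by (intro sum.cong refl *)
  moreover note *[of "\<lambda>i. f i a + f i b + (\<Sum>j\<in>-{a,b}. f i j)"]
  moreover have "(\<Sum>i\<in>-{a,b}. f a i + f b i) = (\<Sum>i\<in>-{a,b}. f a i) + (\<Sum>i\<in>-{a,b}. f b i)"
    by (rule sum.distrib)
  ultimately show ?thesis
    using assms(1)[of a] assms(1)[of b] assms(2)[of b a] by linarith
qed

text \<open>Each \<open>h i\<close> occurs \<open>card W - 1\<close> times in first position and as
  often in second position.\<close>

lemma sum_offdiag_add:
  fixes h :: "'a \<Rightarrow> real"
  assumes "finite W"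
  shows "(\<Sum>i\<in>W. \<Sum>j\<in>W - {i}. h i + h j) = 2 * (real (card W) - 1) * (\<Sum>i\<in>W. h i)"
proof -
  have "(\<Sum>j\<in>W - {i}. h i + h j) = (real (card W) - 2) * h i + (\<Sum>j\<in>W. h j)" if "i \<in> W" for i
  proof -
    have "real (card (W - {i})) = real (card W) - 1"
      using that assms by (metis card_Suc_Diff1 of_nat_Suc add_diff_cancel_right' add.commute)
    then show ?thesis
      using that assms by (simp add: sum.distrib sum_diff1 algebra_simps)
  qed
  then have "(\<Sum>i\<in>W. \<Sum>j\<in>W - {i}. h i + h j)
      = (\<Sum>i\<in>W. (real (card W) - 2) * h i + (\<Sum>j\<in>W. h j))"
    by (rule sum.cong[OF refl])
  also have "\<dots> = (real (card W) - 2) * (\<Sum>i\<in>W. h i) + real (card W) * (\<Sum>i\<in>W. h i)"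
    by (simp add: sum.distrib sum_distrib_left)
  finally show ?thesis by (simp add: algebra_simps)
qed

text \<open>What is left of the products on the five edges of \<open>a b i j\<close> other than
  \<open>a b\<close> after paying for \<open>x a b * y i j\<close>.\<close>

definition quad_slack :: "('a \<Rightarrow> 'a \<Rightarrow> real) \<Rightarrow> ('a \<Rightarrow> 'a \<Rightarrow> real) \<Rightarrow> 'a \<Rightarrow> 'a \<Rightarrow> 'a \<Rightarrow> 'a \<Rightarrow> real" where
  "quad_slack x y a b i j = x a i * y a i + x a j * y a j + x b i * y b i + x b j * y b j
     + x i j * y i j - x a b * y i j"

definition triple_slack :: "('a \<Rightarrow> 'a \<Rightarrow> real) \<Rightarrow> ('a \<Rightarrow> 'a \<Rightarrow> real) \<Rightarrow> 'a \<Rightarrow> 'a \<Rightarrow> 'a \<Rightarrow> real" where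
  "triple_slack x y a b i = x a b * y a b + 2 * x a i * y a i + 2 * x b i * y b i
     - x a b * (y a i + y b i)"

text \<open>From each end \<open>c\<close> of \<open>a b\<close>, step to the nearer of
  \<open>i\<close> and \<open>j\<close> in the sense of \<open>x\<close>: with at most one use of
  the edge \<open>i j\<close> this bounds \<open>x a b\<close>. Each of the two steps is a minimum
  that can be multiplied with \<open>y i j \<le> y c i + y c j\<close>.\<close>

lemma quad_slack_nonneg:
  assumes "semimetric x" "semimetric y"
  shows "0 \<le> quad_slack x y a b i j"
proof -
  note nn = semimetric_nonneg[OF assms(1)] semimetric_nonneg[OF assms(2)]
  have star: "min (x c i) (x c j) * y i j \<le> x c i * y c i + x c j * y c j" for c
  proof -
    have "min (x c i) (x c j) * y i j \<le> min (x c i) (x c j) * (y c i + y c j)"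
      using semimetric_triangle[OF assms(2), of i j c] semimetric_commute[OF assms(2), of i c] nn
      by (intro mult_left_mono) auto
    also have "\<dots> \<le> x c i * y c i + x c j * y c j"
      unfolding distrib_left using nn by (intro add_mono mult_right_mono) auto
    finally show ?thesis .
  qed
  have "x a b \<le> min (x a i) (x a j) + min (x b i) (x b j) + x i j"
    using semimetric_triangle[OF assms(1)] semimetric_commute[OF assms(1)]
      semimetric_nonneg[OF assms(1), of i j] by (smt (verit))
  then have "x a b * y i j \<le> (min (x a i) (x a j) + min (x b i) (x b j) + x i j) * y i j"
    using nn by (intro mult_right_mono) auto
  then show ?thesis
    using star[of a] star[of b] unfolding quad_slack_def by (simp add: distrib_right)
qed

lemma triple_slack_nonneg:
  assumes "semimetric x" "semimetric y" "\<And>i j. x i j \<le> x a b"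
  shows "0 \<le> triple_slack x y a b i"
proof -
  note nn = semimetric_nonneg[OF assms(1)] semimetric_nonneg[OF assms(2)]
  \<comment> \<open>The deficits of the two other edges against the maximal one. They are
    nonnegative by maximality, and the triangle inequality bounds \<open>?p\<close> by
    \<open>x b i\<close>, \<open>?q\<close> by \<open>x a i\<close> and their sum by
    \<open>x a b\<close>.\<close>
  let ?p = "x a b - x a i" and ?q = "x a b - x b i"
  have "?p + ?q \<le> x a b"
    using semimetric_triangle[OF assms(1), of a b i] semimetric_commute[OF assms(1), of i b] by simp
  then have 1: "(?p + ?q) * y a b \<le> x a b * y a b" using nn by (intro mult_right_mono)
  have 2: "?p * y a i \<le> ?p * (y a b + y b i)"
    using assms(3)[of a i] semimetric_triangle[OF assms(2), of a i b] by (intro mult_left_mono) auto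
  have 3: "?q * y b i \<le> ?q * (y a b + y a i)"
    using assms(3)[of b i] semimetric_triangle[OF assms(2), of b i a]
      semimetric_commute[OF assms(2), of b a] by (intro mult_left_mono) auto
  have 4: "?p * y b i \<le> x b i * y b i" and 5: "?q * y a i \<le> x a i * y a i"
    using \<open>?p + ?q \<le> x a b\<close> nn by (auto intro!: mult_right_mono)
  from 1 2 3 4 5 show ?thesis unfolding triple_slack_def by (simp add: algebra_simps)
qed

text \<open>Counting \<open>\<Sum> x i j * y i j\<close> once over all edges and once over all triples gives the factor
  \<open>CARD('a) - 1\<close>. The term \<open>x a b * y i j\<close> is then paid for by the edge \<open>i j\<close> and the triples
  \<open>a i j\<close>, \<open>b i j\<close>, and the terms \<open>x a b * (y a i + y b i)\<close> by the triple \<open>a b i\<close>.\<close>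

lemma slack_identity:
  fixes x y :: "'a::finite \<Rightarrow> 'a \<Rightarrow> real"
  assumes "semimetric x" "semimetric y" "a \<noteq> b"
  shows "(real CARD('a) - 1) * (\<Sum>i\<in>UNIV. \<Sum>j\<in>UNIV. x i j * y i j)
      - x a b * (\<Sum>i\<in>UNIV. \<Sum>j\<in>UNIV. y i j)
    = (real CARD('a) - 2) * (\<Sum>i\<in>-{a,b}. \<Sum>j\<in>-{a,b}. x i j * y i j)
      + 2 * (\<Sum>i\<in>-{a,b}. triple_slack x y a b i)
      + (\<Sum>i\<in>-{a,b}. \<Sum>j\<in>-{a,b}-{i}. quad_slack x y a b i j)"
proof -
  let ?W = "-{a,b}" and ?n = "real CARD('a)"
  have card: "real (card ?W) = ?n - 2"
  proof -
    have "card {a,b} \<le> CARD('a)" by (rule card_mono) auto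
    then show ?thesis using assms(3) by (simp add: Compl_eq_Diff_UNIV card_Diff_subset of_nat_diff)
  qed
  define h where "h i = x a i * y a i + x b i * y b i" for i
  let ?A = "\<Sum>i\<in>?W. h i" and ?B = "\<Sum>i\<in>?W. \<Sum>j\<in>?W. x i j * y i j"
    and ?E = "\<Sum>i\<in>?W. y a i + y b i" and ?F = "\<Sum>i\<in>?W. \<Sum>j\<in>?W. y i j"
  have P: "(\<Sum>i\<in>UNIV. \<Sum>j\<in>UNIV. x i j * y i j) = 2 * (x a b * y a b) + 2 * ?A + ?B"
    unfolding h_def
    by (rule sum_sum_split_pair[of "\<lambda>i j. x i j * y i j", OF _ _ assms(3)])
      (use semimetric_same[OF assms(1)] semimetric_commute[OF assms(1)]
        semimetric_commute[OF assms(2)] in \<open>simp, metis\<close>)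
  have Y: "(\<Sum>i\<in>UNIV. \<Sum>j\<in>UNIV. y i j) = 2 * y a b + 2 * ?E + ?F"
    using semimetric_same[OF assms(2)] assms(3) semimetric_commute[OF assms(2)]
    by (intro sum_sum_split_pair) auto
  have T: "(\<Sum>i\<in>?W. triple_slack x y a b i) = (?n - 2) * (x a b * y a b) + 2 * ?A - x a b * ?E"
    unfolding triple_slack_def h_def
    by (simp add: sum.distrib sum_subtractf sum_distrib_left card algebra_simps)
  have offdiag: "(\<Sum>j\<in>?W-{i}. f j) = (\<Sum>j\<in>?W. f j)" if "f i = 0" "i \<in> ?W" for f :: "'a \<Rightarrow> real" and i
    using that by (simp add: sum_diff1)
  define H where "H i = (\<Sum>j\<in>?W-{i}. h i + h j)" for i
  have "(\<Sum>i\<in>?W. \<Sum>j\<in>?W-{i}. quad_slack x y a b i j)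
      = (\<Sum>i\<in>?W. H i + (\<Sum>j\<in>?W-{i}. x i j * y i j) - x a b * (\<Sum>j\<in>?W-{i}. y i j))"
    unfolding quad_slack_def h_def H_def
    by (intro sum.cong refl) (simp add: sum.distrib sum_subtractf sum_distrib_left algebra_simps)
  also have "\<dots> = (\<Sum>i\<in>?W. H i + (\<Sum>j\<in>?W. x i j * y i j) - x a b * (\<Sum>j\<in>?W. y i j))"
    by (intro sum.cong refl arg_cong2[of _ _ _ _ "(-)"] arg_cong2[of _ _ _ _ "(+)"]
        arg_cong2[of _ _ _ _ "(*)"] offdiag)
      (auto simp: semimetric_same[OF assms(2)])
  also have "\<dots> = (\<Sum>i\<in>?W. H i) + ?B - x a b * ?F"
    by (simp only: sum.distrib sum_subtractf sum_distrib_left[symmetric])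
  \<comment> \<open>Since \<open>?W\<close> has \<open>?n - 2\<close> elements, the factor is
    \<open>2 * (?n - 3)\<close>; the doubled sum of triple slacks supplies \<open>4 * ?A\<close>,
    which makes \<open>2 * (?n - 1) * ?A\<close> in total.\<close>
  also have "(\<Sum>i\<in>?W. H i) = 2 * (?n - 3) * ?A"
    unfolding H_def sum_offdiag_add[OF finite] card by simp
  finally show ?thesis unfolding P Y T by (simp add: algebra_simps)
qed

text \<open>All three sums on the right of \<open>slack_identity\<close> are nonnegative. This gives
  the inequality, and in the case of equality every single summand vanishes.\<close>

lemma
  fixes x y :: "'a::finite \<Rightarrow> 'a \<Rightarrow> real"
  assumes "semimetric x" "semimetric y" "a \<noteq> b" "\<And>i j. x i j \<le> x a b"
  shows max_mult_sum_le: "x a b * (\<Sum>i\<in>UNIV. \<Sum>j\<in>UNIV. y i j)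
      \<le> (real CARD('a) - 1) * (\<Sum>i\<in>UNIV. \<Sum>j\<in>UNIV. x i j * y i j)" (is "?l \<le> ?r")
    and slack_zero: "x a b * (\<Sum>i\<in>UNIV. \<Sum>j\<in>UNIV. y i j)
      = (real CARD('a) - 1) * (\<Sum>i\<in>UNIV. \<Sum>j\<in>UNIV. x i j * y i j) \<Longrightarrow> i \<notin> {a, b} \<Longrightarrow> triple_slack x y a b i = 0 \<and>
        (\<forall>j. j \<notin> {a, b} \<longrightarrow> j \<noteq> i \<longrightarrow> quad_slack x y a b i j = 0 \<and> x i j * y i j = 0)"
proof -
  let ?W = "-{a,b}" and ?n = "real CARD('a)"
  let ?B = "\<Sum>i\<in>?W. \<Sum>j\<in>?W. x i j * y i j" and ?T = "\<Sum>i\<in>?W. triple_slack x y a b i"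
    and ?Q = "\<Sum>i\<in>?W. \<Sum>j\<in>?W-{i}. quad_slack x y a b i j"
  have card: "card {a,b} \<le> CARD('a)" by (rule card_mono) auto
  then have n: "?n \<ge> 2" using assms(3) by simp
  have nn: "0 \<le> x i j * y i j" for i j
    using semimetric_nonneg[OF assms(1)] semimetric_nonneg[OF assms(2)] by simp
  note tn = triple_slack_nonneg[OF assms(1,2,4)] and qn = quad_slack_nonneg[OF assms(1,2)]
  have B: "0 \<le> (?n - 2) * ?B" using n by (intro mult_nonneg_nonneg sum_nonneg nn) simp
  have T: "0 \<le> ?T" by (intro sum_nonneg tn)
  have Q: "0 \<le> ?Q" by (intro sum_nonneg qn)
  note id = slack_identity[OF assms(1-3)]
  show "?l \<le> ?r" using id B T Q by linarith
  assume "?l = ?r" and i: "i \<notin> {a, b}"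
  then have B0: "(?n - 2) * ?B = 0" and T0: "?T = 0" and Q0: "?Q = 0"
    using id B T Q by linarith+
  \<comment> \<open>The coefficient \<open>?n - 2\<close> of \<open>?B\<close> could be zero; a
    point \<open>i\<close> outside \<open>{a, b}\<close> makes it positive.\<close>
  have "card {a,b,i} \<le> CARD('a)" by (rule card_mono) auto
  then have "CARD('a) \<ge> 3" using i assms(3) by auto
  then have "?B = 0" using B0 by simp
  then have "x i j * y i j = 0" if "j \<notin> {a, b}" for j
    using i that nn by (simp add: sum_nonneg_eq_0_iff sum_nonneg)
  moreover have "triple_slack x y a b i = 0"
    using T0 i tn by (simp add: sum_nonneg_eq_0_iff)
  moreover have "quad_slack x y a b i j = 0" if "j \<notin> {a, b}" "j \<noteq> i" for j
    using Q0 i that qn by (simp add: sum_nonneg_eq_0_iff sum_nonneg)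
  ultimately show "triple_slack x y a b i = 0 \<and>
        (\<forall>j. j \<notin> {a, b} \<longrightarrow> j \<noteq> i \<longrightarrow> quad_slack x y a b i j = 0 \<and> x i j * y i j = 0)"
    by blast
qed

section \<open>The equality case of the angle bound\<close>

lemma ex_max_pair:
  fixes x :: "'a::finite \<Rightarrow> 'a \<Rightarrow> real"
  obtains a b where "\<And>i j. x i j \<le> x a b"
proof -
  let ?S = "range (\<lambda>p. x (fst p) (snd p))"
  have "Max ?S \<in> ?S" by (intro Max_in) auto
  then obtain p where p: "Max ?S = x (fst p) (snd p)" by blast
  have "x i j \<le> Max ?S" for i j
    by (rule Max_ge) (auto intro!: image_eqI[of _ _ "(i, j)"])
  then show ?thesis using that p by metis
qed

text \<open>The difference of the two sides is a sum of the nonnegative terms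
  \<open>(m - x i j) * x i j\<close>.\<close>

lemma sum_square_le:
  fixes x :: "'a::finite \<Rightarrow> 'a \<Rightarrow> real"
  assumes "\<And>i j. 0 \<le> x i j" "\<And>i j. x i j \<le> m"
  shows "(\<Sum>i\<in>UNIV. \<Sum>j\<in>UNIV. x i j * x i j) \<le> m * (\<Sum>i\<in>UNIV. \<Sum>j\<in>UNIV. x i j)" (is "?l \<le> ?r")
    and "(\<Sum>i\<in>UNIV. \<Sum>j\<in>UNIV. x i j * x i j) = m * (\<Sum>i\<in>UNIV. \<Sum>j\<in>UNIV. x i j) \<Longrightarrow> x i j = 0 \<or> x i j = m"
proof -
  have e: "?r - ?l = (\<Sum>i\<in>UNIV. \<Sum>j\<in>UNIV. (m - x i j) * x i j)"
    by (simp add: sum_distrib_left sum_subtractf left_diff_distrib)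
  have nn: "0 \<le> (m - x i j) * x i j" for i j
    using assms by simp
  then have "0 \<le> ?r - ?l" unfolding e by (intro sum_nonneg)
  then show "?l \<le> ?r" by simp
  assume "?l = ?r"
  then have "(\<Sum>i\<in>UNIV. \<Sum>j\<in>UNIV. (m - x i j) * x i j) = 0" using e by simp
  then have "(m - x i j) * x i j = 0"
    using nn by (simp add: sum_nonneg_eq_0_iff sum_nonneg)
  then show "x i j = 0 \<or> x i j = m" by auto
qed

text \<open>The equation is the vanishing of a \<open>triple_slack\<close>. Scaled to values 0 and 1
  it reads \<open>1 + 2 * (p * r + q * s) = r + s\<close>, so \<open>r + s\<close> is odd, hence 1,
  and both products vanish.\<close>

lemma two_valued_dichotomy:
  fixes m m' p q r s :: real
  assumes "m > 0" "m' > 0" "p \<in> {0, m}" "q \<in> {0, m}" "r \<in> {0, m'}" "s \<in> {0, m'}"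
    and "m \<le> p + q" "m' \<le> r + s"
    and "m * m' + 2 * p * r + 2 * q * s - m * (r + s) = 0"
  shows "p = m \<and> q = 0 \<and> r = 0 \<and> s = m' \<or> p = 0 \<and> q = m \<and> r = m' \<and> s = 0"
proof -
  have "m * m' > 0" using assms by simp
  then show ?thesis using assms by (auto simp: algebra_simps)
qed

lemma semimetric_starI:
  assumes "semimetric x" "x a b = m" "a \<noteq> b"
    and a: "\<And>i. i \<notin> {a, b} \<Longrightarrow> x a i = m" and b: "\<And>i. i \<notin> {a, b} \<Longrightarrow> x b i = 0"
    and zero: "\<And>i j. i \<notin> {a, b} \<Longrightarrow> j \<notin> {a, b} \<Longrightarrow> x i j = 0"
  shows "x i j = (if (i = a) \<noteq> (j = a) then m else 0)"
proof -
  note same = semimetric_same[OF assms(1)] and sym = semimetric_commute[OF assms(1)]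
  have row: "x a i = m" if "i \<noteq> a" for i
    using that a assms(2) by (cases "i = b") auto
  have b': "x b i = 0" if "i \<noteq> a" for i
    using that b same by (cases "i = b") auto
  have off: "x i j = 0" if "i \<noteq> a" "j \<noteq> a" for i j
  proof (cases "i = b \<or> j = b")
    case True
    then show ?thesis using b'[OF that(1)] b'[OF that(2)] sym[of i j] by auto
  qed (use that zero in auto)
  show ?thesis
    using row[of i] row[of j] off[of i j] same[of a] sym[of i j] by auto
qed

text \<open>The assumption \<open>eq\<close> is the equality case of
  \<open>\<bar>x\<bar> * \<bar>y\<bar> \<le> (CARD('a) - 1) * (x \<bullet> y)\<close>.\<close>

lemma min_angle_stars:
  fixes x y :: "'a::finite \<Rightarrow> 'a \<Rightarrow> real"
  defines "P \<equiv> \<Sum>i\<in>UNIV. \<Sum>j\<in>UNIV. x i j * y i j"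
  assumes x: "semimetric x" and y: "semimetric y" and "P > 0"
    and eq: "((real CARD('a) - 1) * P)\<^sup>2 =
      (\<Sum>i\<in>UNIV. \<Sum>j\<in>UNIV. x i j * x i j) * (\<Sum>i\<in>UNIV. \<Sum>j\<in>UNIV. y i j * y i j)"
  obtains a m where "\<And>i j. x i j = (if (i = a) \<noteq> (j = a) then m else 0)"
proof -
  let ?X = "\<Sum>i\<in>UNIV. \<Sum>j\<in>UNIV. x i j" and ?Y = "\<Sum>i\<in>UNIV. \<Sum>j\<in>UNIV. y i j"
  let ?X2 = "\<Sum>i\<in>UNIV. \<Sum>j\<in>UNIV. x i j * x i j" and ?Y2 = "\<Sum>i\<in>UNIV. \<Sum>j\<in>UNIV. y i j * y i j"
  let ?N = "(real CARD('a) - 1) * P"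
  note xn = semimetric_nonneg[OF x] and yn = semimetric_nonneg[OF y]
  have P': "(\<Sum>i\<in>UNIV. \<Sum>j\<in>UNIV. y i j * x i j) = P"
    unfolding P_def by (simp add: mult.commute)
  obtain a b where ab: "x a b > 0" "y a b > 0"
  proof (rule ccontr)
    assume "\<not> thesis"
    with that have "x i j * y i j \<le> 0" for i j
      using xn[of i j] yn[of i j] by (metis less_eq_real_def mult_zero_left mult_zero_right)
    then have "P \<le> 0" unfolding P_def by (intro sum_nonpos)
    with \<open>P > 0\<close> show False by simp
  qed
  obtain a1 b1 where m1: "\<And>i j. x i j \<le> x a1 b1" using ex_max_pair[of x] by blast
  obtain a2 b2 where m2: "\<And>i j. y i j \<le> y a2 b2" using ex_max_pair[of y] by blast
  define m where "m = x a1 b1"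
  define m' where "m' = y a2 b2"
  have pos: "m > 0" "m' > 0" using ab m1[of a b] m2[of a b] by (auto simp: m_def m'_def)
  then have "a1 \<noteq> b1" "a2 \<noteq> b2" by (auto simp: m_def m'_def semimetric_same[OF x] semimetric_same[OF y])
  then have le: "m * ?Y \<le> ?N" "m' * ?X \<le> ?N"
    using max_mult_sum_le[OF x y _ m1] max_mult_sum_le[OF y x _ m2] P'
    by (simp_all add: m_def m'_def P_def)
  have sq: "?X2 \<le> m * ?X" "?Y2 \<le> m' * ?Y"
    using sum_square_le(1)[of x m] sum_square_le(1)[of y m'] xn yn m1 m2
    by (auto simp: m_def m'_def)
  have entry: "f a b \<le> (\<Sum>i\<in>UNIV. \<Sum>j\<in>UNIV. f i j)" if "\<And>i j. 0 \<le> f i j" for f :: "'a \<Rightarrow> 'a \<Rightarrow> real"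
  proof -
    have "f a b \<le> (\<Sum>j\<in>UNIV. f a j)" using that by (intro member_le_sum) auto
    also have "\<dots> \<le> (\<Sum>i\<in>UNIV. \<Sum>j\<in>UNIV. f i j)"
      using that by (intro member_le_sum[of a UNIV "\<lambda>i. \<Sum>j\<in>UNIV. f i j"] sum_nonneg) auto
    finally show ?thesis .
  qed
  have X: "0 < ?X" "0 < ?Y" using ab entry[of x] entry[of y] xn yn by force+
  have X2: "0 < ?X2" "0 < ?Y2"
    using ab entry[of "\<lambda>i j. x i j * x i j"] entry[of "\<lambda>i j. y i j * y i j"]
    by (auto intro: less_le_trans[of 0 "x a b * x a b"] less_le_trans[of 0 "y a b * y a b"])
  have "0 < m * ?Y" using pos X by simp
  then have "0 \<le> ?N" using le by linarith
  \<comment> \<open>Together these bound \<open>?X2 * ?Y2\<close> by \<open>?N * ?N\<close>, and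
    \<open>eq\<close> says that the two ends agree. Every inequality in \<open>le\<close> and
    \<open>sq\<close> is then an equality.\<close>
  then have chain: "?X2 * ?Y2 \<le> (m * ?X) * (m' * ?Y)" "(m * ?Y) * (m' * ?X) \<le> ?N * ?N"
    using sq le X X2 pos by (auto intro!: mult_mono)
  then have tight: "?X2 * ?Y2 = (m * ?X) * (m' * ?Y)" "(m * ?Y) * (m' * ?X) = ?N * ?N"
    using eq by (simp_all add: power2_eq_square algebra_simps)
  have squeeze: "u = u' \<and> v = v'" if "u \<le> u'" "v \<le> v'" "0 < u" "0 < v" "u * v = u' * v'"
    for u u' v v' :: real
  proof -
    have "u = u'"
    proof (rule ccontr)
      assume "u \<noteq> u'"
      then have "u * v < u' * v" using that by (intro mult_strict_right_mono) auto
      also have "\<dots> \<le> u' * v'" using that by (intro mult_left_mono) auto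
      finally show False using that by simp
    qed
    then show ?thesis using that by simp
  qed
  have t1: "?X2 = m * ?X" "?Y2 = m' * ?Y" using squeeze[OF sq X2 tight(1)] by auto
  have t2: "m * ?Y = ?N" "m' * ?X = ?N" using squeeze[OF le _ _ tight(2)] pos X by auto
  have xv: "x i j \<in> {0, m}" and yv: "y i j \<in> {0, m'}" for i j
    using sum_square_le(2)[of x m i j] sum_square_le(2)[of y m' i j] t1 xn yn m1 m2
    by (auto simp: m_def m'_def)
  \<comment> \<open>As only the values zero and maximum occur, an edge where both are positive is
    maximal for \<open>x\<close> and \<open>y\<close> at once, so the slack lemmas apply to
    \<open>a b\<close> in both orders.\<close>
  have xab: "x a b = m" "y a b = m'" using xv[of a b] yv[of a b] ab by auto
  have neq: "a \<noteq> b" using ab by (auto simp: semimetric_same[OF x])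
  note zx = slack_zero[OF x y neq] and zy = slack_zero[OF y x neq]
  have slx: "triple_slack x y a b i = 0 \<and>
        (\<forall>j. j \<notin> {a, b} \<longrightarrow> j \<noteq> i \<longrightarrow> quad_slack x y a b i j = 0 \<and> x i j * y i j = 0)"
    and sly: "triple_slack y x a b i = 0 \<and>
        (\<forall>j. j \<notin> {a, b} \<longrightarrow> j \<noteq> i \<longrightarrow> quad_slack y x a b i j = 0 \<and> y i j * x i j = 0)"
    if "i \<notin> {a, b}" for i
    using zx[of i] zy[of i] that t2 m1 m2 P' by (auto simp: xab m_def[symmetric] m'_def[symmetric] P_def[symmetric])
  have dich: "x a i = m \<and> x b i = 0 \<and> y a i = 0 \<and> y b i = m'
      \<or> x a i = 0 \<and> x b i = m \<and> y a i = m' \<and> y b i = 0" if "i \<notin> {a, b}" for i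
  proof (rule two_valued_dichotomy[OF pos xv xv yv yv])
    show "m \<le> x a i + x b i" "m' \<le> y a i + y b i"
      using semimetric_triangle[OF x, of a b i] semimetric_triangle[OF y, of a b i]
        semimetric_commute[OF x, of i b] semimetric_commute[OF y, of i b] xab by auto
    show "m * m' + 2 * x a i * y a i + 2 * x b i * y b i - m * (y a i + y b i) = 0"
      using slx[OF that] by (simp add: triple_slack_def xab)
  qed
  have zero: "x i j = 0" if "i \<notin> {a, b}" "j \<notin> {a, b}" for i j
  proof (cases "i = j")
    case False
    \<comment> \<open>By \<open>dich\<close> the products at \<open>a\<close> and \<open>b\<close>
      vanish, so the slack reduces to \<open>- m' * x i j\<close>.\<close>
    then have "quad_slack y x a b i j = 0" "y i j * x i j = 0" using sly that by auto
    then show ?thesis using dich[OF that(1)] dich[OF that(2)] pos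
      by (auto simp: quad_slack_def xab)
  qed (simp add: semimetric_same[OF x])
  have const: "x a i = x a j" if "i \<notin> {a, b}" "j \<notin> {a, b}" for i j
    using semimetric_triangle[OF x, of a i j] semimetric_triangle[OF x, of a j i] zero that by simp
  \<comment> \<open>By \<open>const\<close> all outside points lie on the same side:
    \<open>x\<close> is a star at \<open>a\<close> if they are at distance \<open>m\<close> from
    \<open>a\<close>, and at \<open>b\<close> otherwise.\<close>
  show ?thesis
  proof (cases "\<forall>i. i \<notin> {a, b} \<longrightarrow> x a i = m")
    case True
    then have b: "x b i = 0" if "i \<notin> {a, b}" for i using dich[OF that] that pos by auto
    show ?thesis
      using semimetric_starI[OF x xab(1) neq] True b zero that by blast
  next
    case False
    then obtain i0 where "i0 \<notin> {a, b}" "x a i0 \<noteq> m" by blast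
    then have a: "x a i = 0" if "i \<notin> {a, b}" for i using dich[of i0] const[of i0 i] that by auto
    then have b: "x b i = m" if "i \<notin> {a, b}" for i using dich[OF that] that pos by auto
    have "x b a = m" using xab semimetric_commute[OF x, of a b] by simp
    then have "x i j = (if (i = b) \<noteq> (j = b) then m else 0)" for i j
      by (rule semimetric_starI[OF x _ neq[symmetric]]) (use a b zero in auto)
    then show ?thesis by (rule that)
  qed
qed


section \<open>Vectors in the polar of the cuts\<close>

text \<open>With \<open>b i\<close> the negated coordinate on the edge \<open>i k\<close>, the
  hypotheses make all \<open>b i\<close> and all coordinates away from \<open>k\<close> lie between
  0 and 1. Their weighted sum equals the same weighted sum of their squares, so all are 0 or 1. The
  \<open>b i\<close> sum to 2, which leaves two points \<open>p\<close>, \<open>q\<close>, and the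
  row sums put the remaining 1 on \<open>p q\<close>.\<close>

lemma triangle_vec_characterization:
  fixes a :: "'n::card2 edge_space"
  assumes norm: "a \<bullet> a = 3"
    and single: "\<And>l. a \<bullet> cut_vec {l} = (if l = k then - 2 else 0)"
    and pair: "\<And>p q. p \<noteq> q \<Longrightarrow> a \<bullet> cut_vec {p, q} \<le> 0"
  obtains p q where "p \<noteq> q" "p \<noteq> k" "q \<noteq> k" "a = triangle_vec p q k"
proof -
  let ?W = "UNIV - {k}"
  define \<alpha> where "\<alpha> = dst a"
  define b where "b i = - \<alpha> i k" for i
  have sym: "\<alpha> i j = \<alpha> j i" for i j unfolding \<alpha>_def by (rule dst_commute)
  have same [simp]: "\<alpha> i i = 0" for i unfolding \<alpha>_def by simp
  have split: "(\<Sum>j\<in>UNIV. h j) = h k + (\<Sum>j\<in>?W. h j)" for h :: "'n \<Rightarrow> real"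
    by (rule sum.remove) auto
  have nonneg: "0 \<le> \<alpha> i j" if "i \<in> ?W" "j \<in> ?W" for i j
    using that pair[of i j] inner_cut_pair[of i j a] single[of i] single[of j]
    by (auto simp: \<alpha>_def dst_def)
  have le1: "b i \<le> 1" if "i \<in> ?W" for i
    using that pair[of i k] inner_cut_pair[of i k a] single[of i] single[of k]
    by (auto simp: b_def \<alpha>_def dst_def)
  have row: "(\<Sum>j\<in>?W. \<alpha> i j) = b i" if "i \<in> ?W" for i
    using that single[of i] split[of "\<alpha> i"] by (simp add: inner_cut_single \<alpha>_def[symmetric] b_def)
  have rowk: "(\<Sum>i\<in>?W. b i) = 2"
    using single[of k] split[of "\<alpha> k"]
    by (simp add: inner_cut_single \<alpha>_def[symmetric] b_def sum_negf sym[of _ k])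
  have le: "\<alpha> i j \<le> b i" if "i \<in> ?W" "j \<in> ?W" for i j
    unfolding row[OF that(1), symmetric] using that nonneg by (intro member_le_sum) auto
  have b0: "0 \<le> b i" if "i \<in> ?W" for i
    unfolding row[OF that, symmetric] using that nonneg by (intro sum_nonneg) auto
  \<comment> \<open>Ordered pairs count each edge twice, so the squared norm 3 appears as 6.\<close>
  have "6 = (\<Sum>i\<in>UNIV. \<Sum>j\<in>UNIV. \<alpha> i j * \<alpha> i j)"
    unfolding \<alpha>_def inner_dst norm by simp
  also have "\<dots> = (\<Sum>j\<in>?W. b j * b j) + (\<Sum>i\<in>?W. b i * b i + (\<Sum>j\<in>?W. \<alpha> i j * \<alpha> i j))"
  proof -
    have "(\<Sum>j\<in>UNIV. \<alpha> i j * \<alpha> i j) = b i * b i + (\<Sum>j\<in>?W. \<alpha> i j * \<alpha> i j)" for i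
      unfolding b_def by (subst split) simp
    moreover have "(\<Sum>j\<in>?W. \<alpha> k j * \<alpha> k j) = (\<Sum>j\<in>?W. b j * b j)"
      unfolding b_def by (intro sum.cong refl) (simp add: sym[of _ k])
    ultimately show ?thesis
      by (subst split[of "\<lambda>i. \<Sum>j\<in>UNIV. \<alpha> i j * \<alpha> i j"]) (simp add: b_def)
  qed
  also have "\<dots> = (\<Sum>i\<in>?W. 2 * (b i * b i) + (\<Sum>j\<in>?W. \<alpha> i j * \<alpha> i j))"
    by (simp add: sum.distrib sum_distrib_left[symmetric])
  finally have sq: "(\<Sum>i\<in>?W. 2 * (b i * b i) + (\<Sum>j\<in>?W. \<alpha> i j * \<alpha> i j)) = 6" by simp
  have "(\<Sum>i\<in>?W. 2 * b i + (\<Sum>j\<in>?W. \<alpha> i j)) = (\<Sum>i\<in>?W. 3 * b i)"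
    by (rule sum.cong) (simp_all add: row)
  also have "\<dots> = 6" by (simp only: sum_distrib_left[symmetric] rowk)
  finally have lin: "(\<Sum>i\<in>?W. 2 * b i + (\<Sum>j\<in>?W. \<alpha> i j)) = 6" .
  have gap: "(\<Sum>i\<in>?W. 2 * (b i * (1 - b i)) + (\<Sum>j\<in>?W. \<alpha> i j * (1 - \<alpha> i j))) = 0"
  proof -
    have "(\<Sum>i\<in>?W. 2 * (b i * (1 - b i)) + (\<Sum>j\<in>?W. \<alpha> i j * (1 - \<alpha> i j)))
        = (\<Sum>i\<in>?W. (2 * b i + (\<Sum>j\<in>?W. \<alpha> i j)) - (2 * (b i * b i) + (\<Sum>j\<in>?W. \<alpha> i j * \<alpha> i j)))"
      by (intro sum.cong refl) (simp add: right_diff_distrib sum_subtractf)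
    also have "\<dots> = 0" unfolding sum_subtractf lin sq by simp
    finally show ?thesis .
  qed
  have gb: "0 \<le> b i * (1 - b i)" if "i \<in> ?W" for i
    using b0[OF that] le1[OF that] by simp
  have ga: "0 \<le> \<alpha> i j * (1 - \<alpha> i j)" if "i \<in> ?W" "j \<in> ?W" for i j
    using nonneg[OF that] le[OF that] le1[OF that(1)] by simp
  have gs: "0 \<le> (\<Sum>j\<in>?W. \<alpha> i j * (1 - \<alpha> i j))" if "i \<in> ?W" for i
    using ga[OF that] by (rule sum_nonneg)
  have bv: "b i = 0 \<or> b i = 1" if "i \<in> ?W" for i
  proof -
    have "2 * (b i * (1 - b i)) + (\<Sum>j\<in>?W. \<alpha> i j * (1 - \<alpha> i j)) = 0"
      using gap gb gs that by (subst (asm) sum_nonneg_eq_0_iff) (auto intro!: add_nonneg_nonneg)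
    then have "b i * (1 - b i) = 0" using gb[OF that] gs[OF that] by linarith
    then show ?thesis by auto
  qed
  have "2 = (\<Sum>i\<in>?W. b i)" using rowk by simp
  also have "\<dots> = (\<Sum>i\<in>{i \<in> ?W. b i = 1}. 1)"
    using bv by (intro sum.mono_neutral_cong_right) auto
  also have "\<dots> = real (card {i \<in> ?W. b i = 1})" by simp
  finally have "card {i \<in> ?W. b i = 1} = 2" by linarith
  then obtain p q where pq: "{i \<in> ?W. b i = 1} = {p, q}" "p \<noteq> q" by (auto simp: card_2_iff)
  then have pqk: "p \<in> ?W" "q \<in> ?W" "b p = 1" "b q = 1" by auto
  have bz: "b i = 0" if "i \<in> ?W" "i \<noteq> p" "i \<noteq> q" for i
    using bv[OF that(1)] pq that by blast
  have off: "\<alpha> i j = 0" if "i \<in> ?W" "j \<in> ?W" "i \<noteq> p" "i \<noteq> q" for i j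
    using le[OF that(1,2)] nonneg[OF that(1,2)] bz[OF that(1,3,4)] by simp
  have "(\<Sum>j\<in>?W. \<alpha> p j) = (\<Sum>j\<in>{q}. \<alpha> p j)"
    using pqk off sym[of p] by (intro sum.mono_neutral_right) (auto, metis same)
  then have apq: "\<alpha> p q = 1" using row[OF pqk(1)] pqk by simp
  have coord_a: "coord a i j = \<alpha> i j" if "i \<noteq> j" for i j
    using that by (simp add: \<alpha>_def dst_def)
  have "\<alpha> i j = coord (triangle_vec p q k) i j" if "i \<noteq> j" for i j
  proof -
    consider "i = k" | "j = k" | "i \<noteq> k" "j \<noteq> k" by blast
    then show ?thesis
    proof cases
      case 1
      then have "\<alpha> i j = - b j" by (simp add: b_def sym[of k])
      then show ?thesis using 1 that pqk pq(2) bz[of j] by (auto simp: coord_triangle_vec doubleton_eq_iff)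
    next
      case 2
      then have "\<alpha> i j = - b i" by (simp add: b_def)
      then show ?thesis using 2 that pqk pq(2) bz[of i] by (auto simp: coord_triangle_vec doubleton_eq_iff)
    next
      case 3
      have "\<alpha> i j = (if {i, j} = {p, q} then 1 else 0)"
      proof (cases "{i, j} = {p, q}")
        case True
        then show ?thesis using apq sym[of p q] by (auto simp: doubleton_eq_iff)
      next
        case False
        then have "i \<notin> {p, q} \<or> j \<notin> {p, q}" using that by blast
        then have "\<alpha> i j = 0" using off[of i j] off[of j i] sym[of i j] 3 by auto
        then show ?thesis using False by simp
      qed
      then show ?thesis
        using that 3 pqk pq(2) by (auto simp: coord_triangle_vec doubleton_eq_iff)
    qed
  qed
  then have "a = triangle_vec p q k" by (intro edge_space_eqI) (simp add: coord_a)
  then show ?thesis using that pq(2) pqk by auto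
qed

text \<open>The norm condition means that the two normals have product \<open>- 1\<close>. In the
  two exceptional alternatives \<open>m\<close> can be read off \<open>u\<close> and fixes one of
  the normals; this is what later bounds the number of exceptions.\<close>

lemma triangle_pair_cases:
  fixes u :: "'n::card2 edge_space"
  assumes pqk: "p \<noteq> q" "p \<noteq> k" "q \<noteq> k" and rsj: "r \<noteq> s" "r \<noteq> j" "s \<noteq> j" and jk: "j \<noteq> k"
    and u: "u = triangle_vec p q k + triangle_vec r s j" and norm: "u \<bullet> u = 4"
  obtains "u = - 2 *\<^sub>R axis (uedge j k) 1"
  | m where "m \<noteq> j" "m \<noteq> k" "triangle_vec p q k = triangle_vec m j k"
      "\<And>a. a \<noteq> j \<Longrightarrow> a \<noteq> k \<Longrightarrow> coord u k a = (if a = m then - 1 else 0)"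
  | m where "m \<noteq> j" "m \<noteq> k" "triangle_vec r s j = triangle_vec m k j"
      "\<And>a. a \<noteq> j \<Longrightarrow> a \<noteq> k \<Longrightarrow> coord u j a = (if a = m then - 1 else 0)"
proof -
  have "triangle_vec p q k \<bullet> triangle_vec r s j = - 1"
    using norm pqk rsj unfolding u
    by (simp add: inner_add_left inner_add_right norm_triangle_vec
        inner_commute[of "triangle_vec r s j" "triangle_vec p q k"])
  then have i: "coord (triangle_vec r s j) p q - coord (triangle_vec r s j) p k
      - coord (triangle_vec r s j) q k = - 1"
    by (simp add: inner_triangle_vec)
  consider "j \<noteq> p" "j \<noteq> q" | m where "m \<noteq> j" "m \<noteq> k" "{p, q} = {m, j}"
    using pqk jk by fast
  then show ?thesis
  proof cases
    case 1
    \<comment> \<open>No edge of \<open>p q k\<close> contains \<open>j\<close>, so the other normal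
      can only contribute its value 1 on \<open>r s\<close>. The product is negative only if
      \<open>r s\<close> is one of the negative edges \<open>p k\<close>,
      \<open>q k\<close>.\<close>
    then have "\<exists>m. {r, s} = {m, k} \<and> m \<in> {p, q}"
      using i pqk rsj jk by (auto simp: coord_triangle_vec doubleton_eq_iff split: if_splits)
    then obtain m where m: "{r, s} = {m, k}" "m \<in> {p, q}" by blast
    then have mm: "m \<noteq> j" "m \<noteq> k" using 1 pqk by auto
    have t: "triangle_vec r s j = triangle_vec m k j"
      using m(1) triangle_vec_commute[of r s j] by (auto simp: doubleton_eq_iff)
    have "coord u j a = (if a = m then - 1 else 0)" if "a \<noteq> j" "a \<noteq> k" for a
      unfolding u t using that mm 1 pqk jk by (auto simp: coord_triangle_vec doubleton_eq_iff)
    with mm t show ?thesis using that(3) by blast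
  next
    case 2
    have t: "triangle_vec p q k = triangle_vec m j k"
      using 2(3) triangle_vec_commute[of p q k] by (auto simp: doubleton_eq_iff)
    have i': "coord (triangle_vec r s j) m j - coord (triangle_vec r s j) m k
        - coord (triangle_vec r s j) j k = - 1"
      using \<open>triangle_vec p q k \<bullet> triangle_vec r s j = - 1\<close> unfolding t by (simp add: inner_triangle_vec)
    show ?thesis
    proof (cases "k \<in> {r, s}")
      case True
      \<comment> \<open>The common edge \<open>j k\<close> contributes 1 to the product. Reaching
        \<open>- 1\<close> requires both other edges to be shared, with opposite signs.\<close>
      then have "{r, s} = {m, k}"
        using i' 2 rsj jk by (auto simp: coord_triangle_vec doubleton_eq_iff split: if_splits)
      then have "triangle_vec r s j = triangle_vec m k j"
        using triangle_vec_commute[of r s j] by (auto simp: doubleton_eq_iff)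
      then have "u = - 2 *\<^sub>R axis (uedge j k) 1"
        unfolding u t using triangle_vec_sum[of m j k] 2 jk by simp
      then show ?thesis by (rule that(1))
    next
      case False
      have "coord u k a = (if a = m then - 1 else 0)" if "a \<noteq> j" "a \<noteq> k" for a
        unfolding u t using that False 2 rsj jk by (auto simp: coord_triangle_vec doubleton_eq_iff)
      with 2 t show ?thesis using that(2) by blast
    qed
  qed
qed

section \<open>Isometries of a cone between the cuts and the semimetrics\<close>

text \<open>The setting for at least three points: \<open>C\<close> contains the cuts and satisfies
  the triangle inequalities, and \<open>g\<close> is given by its preservation of inner
  products.\<close>

locale cut_cone_isometry =
  fixes C :: "'n::card2 edge_space set" and g :: "'n edge_space \<Rightarrow> 'n edge_space"
  assumes card3: "3 \<le> CARD('n)"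
    and cut_mem: "cut_vec S \<in> C"
    and triangle_le: "x \<in> C \<Longrightarrow> i \<noteq> j \<Longrightarrow> i \<noteq> k \<Longrightarrow> j \<noteq> k \<Longrightarrow> triangle_vec i j k \<bullet> x \<le> 0"
    and lin: "linear g"
    and inner: "g x \<bullet> g y = x \<bullet> y"
    and image: "g ` C = C"
begin

lemma ex_outside: "\<exists>k :: 'n. k \<noteq> i \<and> k \<noteq> j"
proof (rule ccontr)
  assume "\<not> ?thesis"
  then have "UNIV \<subseteq> {i, j}" by blast
  then have "CARD('n) \<le> card {i, j}" by (intro card_mono) auto
  then show False using card3 card_insert_le_m1[of 2 "{j}" i] by simp
qed

text \<open>The two triangle inequalities with positive edges \<open>k i\<close> and
  \<open>k j\<close>, for a third point \<open>k\<close>, add up to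
  \<open>- 2 * coord x i j \<le> 0\<close>.\<close>

lemma coord_nonneg:
  assumes "x \<in> C" "i \<noteq> j"
  shows "0 \<le> coord x i j"
proof -
  obtain k where "k \<noteq> i" "k \<noteq> j" using ex_outside by blast
  then show ?thesis
    using triangle_le[OF assms(1), of k i j] triangle_le[OF assms(1), of k j i] assms(2)
    by (simp add: inner_triangle_vec uedge_commute)
qed

lemma semimetric_dst:
  assumes "x \<in> C"
  shows "semimetric (dst x)"
proof -
  have "dst x i j \<le> dst x i k + dst x k j" for i j k
    using triangle_le[OF assms, of i j k] coord_nonneg[OF assms, of i k]
    by (auto simp: dst_def inner_triangle_vec uedge_commute)
  then show ?thesis by (simp add: semimetric_def dst_commute)
qed

lemma image_mem: "x \<in> C \<Longrightarrow> g x \<in> C"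
  using image by blast

lemma inj: "g x = g y \<Longrightarrow> x = y"
proof -
  assume "g x = g y"
  then have "g (x - y) = 0" by (simp add: linear_diff[OF lin])
  then have "(x - y) \<bullet> (x - y) = 0" by (metis inner inner_zero_left)
  then show "x = y" by simp
qed

text \<open>Cuts at two different points have product 1 and squared norm \<open>n - 1\<close>, which
  is the equality case of the angle bound. Their images lie in \<open>C\<close> and are semimetrics
  at the same angle, so \<open>min_angle_stars\<close> applies to them.\<close>

lemma image_cut_single: "\<exists>a. g (cut_vec {i}) = cut_vec {a}"
proof -
  obtain j where j: "j \<noteq> i" using ex_outside by blast
  let ?x = "g (cut_vec {i})" and ?y = "g (cut_vec {j})"
  have mem: "?x \<in> C" "?y \<in> C" using cut_mem image_mem by blast+
  obtain a m where am: "\<And>p q. dst ?x p q = (if (p = a) \<noteq> (q = a) then m else 0)"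
  proof (rule min_angle_stars[OF semimetric_dst[OF mem(1)] semimetric_dst[OF mem(2)]])
    show "((real CARD('n) - 1) * (\<Sum>p\<in>UNIV. \<Sum>q\<in>UNIV. dst ?x p q * dst ?y p q))\<^sup>2
        = (\<Sum>p\<in>UNIV. \<Sum>q\<in>UNIV. dst ?x p q * dst ?x p q) * (\<Sum>p\<in>UNIV. \<Sum>q\<in>UNIV. dst ?y p q * dst ?y p q)"
      using j by (simp add: inner_dst inner cut_single_inner_cut_single power2_eq_square algebra_simps)
  qed (use j in \<open>auto simp: inner_dst inner cut_single_inner_cut_single\<close>)
  have x: "?x = m *\<^sub>R cut_vec {a}"
  proof (rule edge_space_eqI)
    fix p q :: 'n assume "p \<noteq> q"
    then show "coord ?x p q = coord (m *\<^sub>R cut_vec {a}) p q"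
      using am[of p q] by (simp add: dst_def coord_cut_vec)
  qed
  \<comment> \<open>Preservation of the norm leaves \<open>m = 1\<close> or \<open>m = - 1\<close>;
    nonnegativity of the image decides.\<close>
  have "m * m * (real CARD('n) - 1) = real CARD('n) - 1"
    using inner[of "cut_vec {i}" "cut_vec {i}"] unfolding x by (simp add: cut_single_inner_cut_single)
  then have "m * m = 1" using card3 by simp
  moreover have "0 \<le> m"
  proof -
    obtain c where "c \<noteq> a" using ex_outside by blast
    then show ?thesis
      using am[of a c] semimetric_nonneg[OF semimetric_dst[OF mem(1)], of a c] by simp
  qed
  ultimately have "m = 1" by (auto simp: square_eq_1_iff)
  then show ?thesis using x by auto
qed

section \<open>The permutation \<sigma> and the images of the triangle normals\<close>

definition \<sigma> :: "'n \<Rightarrow> 'n" where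
  "\<sigma> i = (SOME a. g (cut_vec {i}) = cut_vec {a})"

lemma g_cut_single: "g (cut_vec {i}) = cut_vec {\<sigma> i}"
  unfolding \<sigma>_def using image_cut_single by (rule someI_ex)

lemma inj_\<sigma>: "inj \<sigma>"
proof (rule injI)
  fix i j assume "\<sigma> i = \<sigma> j"
  then have "cut_vec {i} = cut_vec {j}" using g_cut_single inj by metis
  then have "cut_vec {i} \<bullet> cut_vec {j} = real CARD('n) - 1"
    using cut_single_inner_cut_single[of i i] by simp
  then show "i = j" using card3 by (auto simp: cut_single_inner_cut_single split: if_splits)
qed

lemma bij_\<sigma>: "bij \<sigma>"
  using inj_\<sigma> finite_UNIV_inj_surj[OF finite inj_\<sigma>] by (simp add: bij_def)

lemma triangle_image:
  assumes "i \<noteq> j" "i \<noteq> k" "j \<noteq> k"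
  obtains p q where "p \<noteq> q" "p \<noteq> \<sigma> k" "q \<noteq> \<sigma> k" "g (triangle_vec i j k) = triangle_vec p q (\<sigma> k)"
proof (rule triangle_vec_characterization[of "g (triangle_vec i j k)" "\<sigma> k"])
  show "g (triangle_vec i j k) \<bullet> g (triangle_vec i j k) = 3"
    using assms by (simp add: inner norm_triangle_vec)
  show "g (triangle_vec i j k) \<bullet> cut_vec {l} = (if l = \<sigma> k then - 2 else 0)" for l
  proof -
    obtain l' where l: "l = \<sigma> l'" using bij_\<sigma> by (metis bij_pointE)
    have "g (triangle_vec i j k) \<bullet> cut_vec {l} = triangle_vec i j k \<bullet> cut_vec {l'}"
      unfolding l g_cut_single[symmetric] by (rule inner)
    then show ?thesis
      using assms by (simp add: triangle_inner_cut_single l inj_eq[OF inj_\<sigma>])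
  qed
  show "g (triangle_vec i j k) \<bullet> cut_vec {p, q} \<le> 0" for p q
  proof -
    \<comment> \<open>The preimage \<open>x\<close> of this cut need not be a cut, but it lies in
      \<open>C\<close>, where the triangle inequality holds.\<close>
    obtain x where "x \<in> C" "cut_vec {p, q} = g x" using cut_mem image by blast
    then show ?thesis using triangle_le assms by (simp add: inner)
  qed
qed (rule that)

section \<open>The images of the unit vectors\<close>

lemma axis_image_card3:
  assumes "CARD('n) = 3" "j \<noteq> k"
  shows "g (axis (uedge j k) 1) = axis (uedge (\<sigma> j) (\<sigma> k)) 1"
proof -
  \<comment> \<open>On three points the single-point cuts already span the space, so the action on
    them determines \<open>g\<close>.\<close>
  have e: "axis (uedge j k) 1 = (1/2) *\<^sub>R (cut_vec {j} + cut_vec {k} - cut_vec {i})"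
    if "i \<noteq> j" "i \<noteq> k" "j \<noteq> k" for i j k :: 'n
  proof (rule edge_space_eqI)
    fix p q :: 'n assume pq: "p \<noteq> q"
    have "UNIV = {i, j, k}"
      using assms(1) that by (intro card_subset_eq[symmetric]) auto
    then have "p \<in> {i, j, k}" "q \<in> {i, j, k}" by blast+
    then show "coord (axis (uedge j k) 1) p q
        = coord ((1/2) *\<^sub>R (cut_vec {j} + cut_vec {k} - cut_vec {i})) p q"
      using that pq by (auto simp: coord_cut_vec coord_axis doubleton_eq_iff)
  qed
  obtain i where i: "i \<noteq> j" "i \<noteq> k" using ex_outside by blast
  then show ?thesis
    using assms(2)
    by (simp add: e[of i j k] e[of "\<sigma> i" "\<sigma> j" "\<sigma> k"] inj_eq[OF inj_\<sigma>] linear_scale[OF lin]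
        linear_add[OF lin] linear_diff[OF lin] g_cut_single)
qed

lemma axis_image_card5:
  assumes "5 \<le> CARD('n)" "j \<noteq> k"
  shows "g (axis (uedge j k) 1) = axis (uedge (\<sigma> j) (\<sigma> k)) 1"
proof -
  let ?u = "g (- 2 *\<^sub>R axis (uedge j k) 1)" and ?j = "\<sigma> j" and ?k = "\<sigma> k"
  have jk: "?j \<noteq> ?k" using assms(2) by (simp add: inj_eq[OF inj_\<sigma>])
  have norm: "?u \<bullet> ?u = 4" by (simp add: inner inner_axis_axis)
  \<comment> \<open>The exceptional alternatives of \<open>triangle_pair_cases\<close>: the second
    is \<open>T j k i m\<close>, the third is \<open>T k j i m\<close>.\<close>
  define T where "T j k i m \<longleftrightarrow> m \<noteq> \<sigma> j \<and> m \<noteq> \<sigma> k \<and> g (triangle_vec i j k) = triangle_vec m (\<sigma> j) (\<sigma> k)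
    \<and> (\<forall>a. a \<noteq> \<sigma> j \<longrightarrow> a \<noteq> \<sigma> k \<longrightarrow> coord ?u (\<sigma> k) a = (if a = m then - 1 else 0))" for j k i m
  \<comment> \<open>The vector \<open>?u\<close> does not depend on \<open>i\<close> and determines
    \<open>m\<close>, hence the image of the normal; injectivity of \<open>g\<close> then recovers
    \<open>i\<close>.\<close>
  have uniq: "i = l" if "T j k i m" "T j k l m'" "i \<noteq> j" "i \<noteq> k" "l \<noteq> j" "l \<noteq> k" "j \<noteq> k" for j k i l m m'
  proof -
    have "coord ?u (\<sigma> k) m = - 1" using that(1) unfolding T_def by simp
    then have "m = m'" using that(1,2) unfolding T_def by (metis zero_neq_neg_one)
    then have "g (triangle_vec i j k) = g (triangle_vec l j k)"
      using that(1,2) unfolding T_def by simp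
    then show ?thesis using inj triangle_vec_inject that(3-7) by blast
  qed
  have cases: "?u = - 2 *\<^sub>R axis (uedge ?j ?k) 1 \<or> (\<exists>m. T j k i m) \<or> (\<exists>m. T k j i m)"
    if i: "i \<noteq> j" "i \<noteq> k" for i
  proof -
    obtain p q where pq: "p \<noteq> q" "p \<noteq> ?k" "q \<noteq> ?k" "g (triangle_vec i j k) = triangle_vec p q ?k"
      using triangle_image i assms(2) by metis
    obtain r s where rs: "r \<noteq> s" "r \<noteq> ?j" "s \<noteq> ?j" "g (triangle_vec i k j) = triangle_vec r s ?j"
      using triangle_image i assms(2) by metis
    have "?u = triangle_vec p q ?k + triangle_vec r s ?j"
      unfolding pq(4)[symmetric] rs(4)[symmetric] triangle_vec_sum[OF i assms(2), symmetric]
      by (rule linear_add[OF lin])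
    from pq(1-3) rs(1-3) jk this norm show ?thesis
      by (rule triangle_pair_cases) (auto simp: T_def pq(4) rs(4))
  qed
  \<comment> \<open>\<open>T\<close> holds for at most one \<open>i\<close> in each order of \<open>j, k\<close>, but three values of \<open>i\<close> are available.\<close>
  have "?u = - 2 *\<^sub>R axis (uedge ?j ?k) 1"
  proof (rule ccontr)
    assume "\<not> ?thesis"
    then have types: "(\<exists>m. T j k i m) \<or> (\<exists>m. T k j i m)" if "i \<noteq> j" "i \<noteq> k" for i
      using cases that by blast
    have "3 \<le> card (UNIV - {j, k})" using assms by (simp add: card_Diff_subset)
    then obtain W where "W \<subseteq> UNIV - {j, k}" "card W = 3" by (metis obtain_subset_with_card_n)
    then obtain i1 i2 i3 where i: "{i1, i2, i3} \<subseteq> UNIV - {j, k}" "i1 \<noteq> i2" "i1 \<noteq> i3" "i2 \<noteq> i3"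
      by (auto simp: card_3_iff)
    then have "\<And>i. i \<in> {i1, i2, i3} \<Longrightarrow> i \<noteq> j \<and> i \<noteq> k" by blast
    then show False
      using types[of i1] types[of i2] types[of i3] uniq assms(2) i(2-4)
      by (metis insertI1 insertI2)
  qed
  then show ?thesis by (simp add: linear_scale[OF lin] linear_neg[OF lin])
qed

lemma induced:
  assumes "CARD('n) \<noteq> 4"
  shows "induced_by g \<sigma>"
  unfolding induced_by_def
proof (intro allI impI)
  fix x :: "'n edge_space" and i j :: 'n assume ij: "i \<noteq> j"
  have "CARD('n) = 3 \<or> 5 \<le> CARD('n)" using assms card3 by linarith
  then have "g (axis (uedge i j) 1) = axis (uedge (\<sigma> i) (\<sigma> j)) 1"
    using axis_image_card3 axis_image_card5 ij by blast
  then have "coord (g x) (\<sigma> i) (\<sigma> j) = g x \<bullet> g (axis (uedge i j) 1)"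
    by (simp add: inner_axis_uedge)
  also have "\<dots> = coord x i j" by (simp add: inner inner_axis_uedge)
  finally show "coord (g x) (\<sigma> i) (\<sigma> j) = coord x i j" .
qed

end

section \<open>The case of two points, and the conclusion\<close>

lemma extreme_ray_minus_notin:
  assumes "spans_extreme_ray v C" "v \<in> C"
  shows "- v \<notin> C"
proof
  assume "- v \<in> C"
  have v: "v \<noteq> 0" and face: "(cone hull {v}) face_of C"
    using assms(1) by (auto simp: spans_extreme_ray_def)
  have "v \<noteq> - v"
  proof
    assume "v = - v"
    then have "v + v = v + - v" by (rule arg_cong)
    then have "2 *\<^sub>R v = 0" unfolding scaleR_2 by simp
    then show False using v by simp
  qed
  \<comment> \<open>The origin is the midpoint of \<open>v\<close> and \<open>- v\<close> and lies
    on the ray, so the face property would put \<open>- v\<close> on the ray as well.\<close>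
  then have "0 \<in> open_segment v (- v)"
    by (auto simp: in_segment intro!: exI[of _ "1/2"] simp flip: scaleR_left_distrib)
  moreover have "0 \<in> cone hull {v}" by (auto simp: cone_hull_expl intro!: exI[of _ 0])
  ultimately have "- v \<in> cone hull {v}"
    using face assms(2) \<open>- v \<in> C\<close> unfolding face_of_def by blast
  then obtain c where "c \<ge> 0" "- v = c *\<^sub>R v" by (auto simp: cone_hull_expl)
  then have "(1 + c) *\<^sub>R v = 0" by (simp add: scaleR_left_distrib flip: \<open>- v = c *\<^sub>R v\<close>)
  then show False using v \<open>c \<ge> 0\<close> by simp
qed

text \<open>Two points have a single edge, so the space is a line and \<open>g\<close> is
  multiplication by 1 or \<open>- 1\<close>. The latter would map \<open>v\<close> to
  \<open>- v\<close>, which extremality keeps out of \<open>C\<close>.\<close>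

lemma isometry_card2_id:
  fixes C :: "'n::card2 edge_space set"
  assumes "CARD('n) = 2" "spans_extreme_ray v C" "v \<in> C"
    and "linear g" "g ` C = C" "\<And>x. norm (g x) = norm x"
  shows "g x = x"
proof -
  have "e = e'" for e e' :: "'n edge"
  proof -
    have "Rep_edge e = UNIV" for e :: "'n edge"
      using Rep_edge[of e] assms(1) by (intro card_subset_eq) auto
    then show ?thesis by (metis Rep_edge_inject)
  qed
  then have eqI: "x = y" if "x $ e = y $ e" for x y :: "'n edge_space" and e
    unfolding vec_eq_iff using that by metis
  have v: "v \<noteq> 0" using assms(2) by (simp add: spans_extreme_ray_def)
  then obtain e where e: "v $ e \<noteq> 0" by (metis vec_eq_iff zero_index)
  have one_dim: "\<exists>c. x = c *\<^sub>R v" for x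
    using e by (intro exI[of _ "x $ e / v $ e"] eqI[of _ e]) simp
  obtain c where c: "g v = c *\<^sub>R v" using one_dim by blast
  have "\<bar>c\<bar> = 1" using v assms(6)[of v] c by simp
  moreover have "c \<noteq> - 1"
    using c extreme_ray_minus_notin[OF assms(2,3)] assms(3,5) by force
  ultimately have "g v = v" using c by (simp add: abs_if split: if_splits)
  then show ?thesis using one_dim[of x] assms(4) by (metis linear_scale)
qed

theorem theorem2:
  fixes C :: "'n::card2 edge_space set"
    and g :: "'n edge_space \<Rightarrow> 'n edge_space"
  assumes "CARD('n) \<noteq> 4"
    and "polyhedron C" and "convex_cone C"
    and "\<And>S. cut_vec S \<noteq> 0 \<Longrightarrow> spans_extreme_ray (cut_vec S) C"
    and "\<And>i j k. i \<noteq> j \<Longrightarrow> i \<noteq> k \<Longrightarrow> j \<noteq> k \<Longrightarrow> facet_inducing (triangle_vec i j k) C"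
    and "cone_isometry g C"
  shows "\<exists>\<sigma>. bij \<sigma> \<and> induced_by g \<sigma>"
proof -
  have lin: "linear g" and im: "g ` C = C"
    using assms(6) by (auto simp: cone_isometry_def)
  have norm: "norm (g x) = norm x" for x
    using assms(6) unfolding cone_isometry_def by (metis dist_0_norm linear_0)
  have zero: "0 \<in> C" using assms(3) by (simp add: convex_cone_contains_0)
  have cut: "cut_vec S \<in> C" for S
  proof (cases "cut_vec S = 0")
    case False
    then have "(cone hull {cut_vec S}) face_of C"
      using assms(4) by (simp add: spans_extreme_ray_def)
    then show ?thesis using face_of_imp_subset hull_inc[of "cut_vec S" "{cut_vec S}"] by blast
  qed (simp add: zero)
  show ?thesis
  proof (cases "CARD('n) = 2")
    case True
    obtain i j :: 'n where "i \<noteq> j" using uedge_cases by metis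
    then have "coord (cut_vec {i}) i j = 1" by (simp add: coord_cut_vec)
    then have "cut_vec {i} \<noteq> 0" by auto
    then have "g x = x" for x
      using isometry_card2_id[OF True assms(4) cut lin im norm] by blast
    \<comment> \<open>Both permutations of two points fix the only edge; the identity is chosen as
      witness.\<close>
    then have "induced_by g id" by (simp add: induced_by_def)
    then show ?thesis using bij_id by blast
  next
    case False
    interpret cut_cone_isometry C g
    proof (rule cut_cone_isometry.intro)
      show "3 \<le> CARD('n)" using False two_le_card[where 'a = 'n] by linarith
      show "triangle_vec i j k \<bullet> x \<le> 0" if "x \<in> C" "i \<noteq> j" "i \<noteq> k" "j \<noteq> k" for x i j k
        using assms(5) that by (simp add: facet_inducing_def)
      show "g x \<bullet> g y = x \<bullet> y" for x y
        \<comment> \<open>Polarization: a linear map that preserves norms preserves inner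
          products.\<close>
        using norm by (simp add: dot_norm flip: linear_add[OF lin])
    qed (use cut lin im in auto)
    show ?thesis using bij_\<sigma> induced[OF assms(1)] by blast
  qed
qed

end
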